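(* Let $p\ge 2$ be a prime and let $G$ be a metabelian $p$-group with abelianization $G/G'$ of type $(p,p)$. (1) If $G$ is of coclass $\mathrm{cc}(G)\ge 2$ and nilpotency class $\mathrm{cl}(G)=3$, then $p\ge 3$ must be odd and the coclass must be $\mathrm{cc}(G)=2$ exactly. (2) If $G$ is of coclass $\mathrm{cc}(G)=1$ and nilpotency class $\mathrm{cl}(G)=2$, then $G$ is an extra special $p$-group of order $p^3$ and exponent $p$ or $p^2$. In both cases, there occurs a total polarization and no stabilization at all; explicitly, $\mathrm{Pol}_\pi(G)=\{1,\ldots,p+1\}$ and $\mathrm{Stb}_\pi(G)=\emptyset$.
   Context: "Type $(p,p)$" means $C_p\times C_p$. The coclass of a $p$-group of order $p^n$ and nilpotency class $c$ is $\mathrm{cc}(G)=n-c$. $\gamma_1(G)=G$, $\gamma_j(G)=[\gamma_{j-1}(G),G]$. The parent of $G$ is $\pi(G)=G/\gamma_c(G)$ with $c=\mathrm{cl}(G)$, and $\pi:G\to G/\gamma_c(G)$ is the natural projection, with kernel $\gamma_c(G)$. Let $U_1,\ldots,U_{p+1}$ be the $p+1$ maximal subgroups of $G$. Then $\mathrm{Stb}_\pi(G)=\{1\le i\le p+1\mid\ker(\pi)\le U_i'\}$ and $\mathrm{Pol}_\pi(G)=\{1\le i\le p+1\mid\ker(\pi)\not\le U_i'\}$. *)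

theory Defs
  imports "HOL-Algebra.Algebra" "HOL-Computational_Algebra.Primes"
begin

definition p_group :: "nat \<Rightarrow> ('a, 'b) monoid_scheme \<Rightarrow> bool" where
  "p_group p G \<longleftrightarrow> group G \<and> finite (carrier G) \<and> (\<exists>n. order G = p ^ n)"

definition commutator_subgroup :: "('a, 'b) monoid_scheme \<Rightarrow> 'a set \<Rightarrow> 'a set \<Rightarrow> 'a set" where
  "commutator_subgroup G H K =
     generate G {h \<otimes>\<^bsub>G\<^esub> k \<otimes>\<^bsub>G\<^esub> inv\<^bsub>G\<^esub> h \<otimes>\<^bsub>G\<^esub> inv\<^bsub>G\<^esub> k | h k. h \<in> H \<and> k \<in> K}"

text \<open>The lower central series is indexed from 1; the value at 0 is a dummy.\<close>

fun lower_central :: "('a, 'b) monoid_scheme \<Rightarrow> nat \<Rightarrow> 'a set" where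
  "lower_central G 0 = carrier G"
| "lower_central G (Suc 0) = carrier G"
| "lower_central G (Suc (Suc j)) =
     commutator_subgroup G (lower_central G (Suc j)) (carrier G)"

text \<open>Only meaningful for nilpotent groups, in particular for finite $p$-groups.\<close>

definition nilpotency_class :: "('a, 'b) monoid_scheme \<Rightarrow> nat" where
  "nilpotency_class G = (LEAST c. lower_central G (Suc c) = {\<one>\<^bsub>G\<^esub>})"

text \<open>
  For a group of order $p^n$ the multiplicity is $n$. The subtraction does not truncate
  for a $p$-group: the lower central series descends strictly, so the class is at most $n$.
\<close>

definition coclass :: "nat \<Rightarrow> ('a, 'b) monoid_scheme \<Rightarrow> nat" where
  "coclass p G = Factorial_Ring.multiplicity p (order G) - nilpotency_class G"

definition metabelian :: "('a, 'b) monoid_scheme \<Rightarrow> bool" where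
  "metabelian G \<longleftrightarrow> derived G (derived G (carrier G)) = {\<one>\<^bsub>G\<^esub>}"

definition abelianization :: "('a, 'b) monoid_scheme \<Rightarrow> 'a set monoid" where
  "abelianization G = G Mod derived G (carrier G)"

definition maximal_subgroups :: "('a, 'b) monoid_scheme \<Rightarrow> 'a set set" where
  "maximal_subgroups G =
     {M. subgroup M G \<and> M \<noteq> carrier G \<and>
         (\<forall>H. subgroup H G \<and> M \<subseteq> H \<longrightarrow> H = M \<or> H = carrier G)}"

definition parent :: "('a, 'b) monoid_scheme \<Rightarrow> 'a set monoid" where
  "parent G = G Mod lower_central G (nilpotency_class G)"

definition parent_proj :: "('a, 'b) monoid_scheme \<Rightarrow> 'a \<Rightarrow> 'a set" where
  "parent_proj G x = lower_central G (nilpotency_class G) #>\<^bsub>G\<^esub> x"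

text \<open>In the next two definitions \<open>U\<close> enumerates the maximal subgroups of \<open>G\<close> by $1, \dots, p+1$.\<close>

definition Stb :: "nat \<Rightarrow> ('a, 'b) monoid_scheme \<Rightarrow> (nat \<Rightarrow> 'a set) \<Rightarrow> nat set" where
  "Stb p G U =
     {i. 1 \<le> i \<and> i \<le> p + 1 \<and> kernel G (parent G) (parent_proj G) \<subseteq> derived G (U i)}"

definition Pol :: "nat \<Rightarrow> ('a, 'b) monoid_scheme \<Rightarrow> (nat \<Rightarrow> 'a set) \<Rightarrow> nat set" where
  "Pol p G U =
     {i. 1 \<le> i \<and> i \<le> p + 1 \<and> \<not> kernel G (parent G) (parent_proj G) \<subseteq> derived G (U i)}"

definition group_center :: "('a, 'b) monoid_scheme \<Rightarrow> 'a set" where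
  "group_center G = {z \<in> carrier G. \<forall>x \<in> carrier G. z \<otimes>\<^bsub>G\<^esub> x = x \<otimes>\<^bsub>G\<^esub> z}"

definition group_exponent :: "('a, 'b) monoid_scheme \<Rightarrow> nat" where
  "group_exponent G = (LEAST m. 0 < m \<and> (\<forall>x \<in> carrier G. x [^]\<^bsub>G\<^esub> m = \<one>\<^bsub>G\<^esub>))"

definition elementary_abelian :: "nat \<Rightarrow> ('a, 'b) monoid_scheme \<Rightarrow> bool" where
  "elementary_abelian p E \<longleftrightarrow>
     comm_group E \<and> (\<forall>x \<in> carrier E. x [^]\<^bsub>E\<^esub> p = \<one>\<^bsub>E\<^esub>)"

text \<open>Nontriviality of the central quotient excludes the cyclic group of order $p$.\<close>

definition extra_special :: "nat \<Rightarrow> ('a, 'b) monoid_scheme \<Rightarrow> bool" where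
  "extra_special p G \<longleftrightarrow>
     p_group p G \<and> card (group_center G) = p \<and>
     elementary_abelian p (G Mod group_center G) \<and> order (G Mod group_center G) \<noteq> 1"

end

theory Submission
  imports Defs
begin

text \<open>
  Write $D = \gamma_2(G) = G'$ and $N = \gamma_3(G)$. Since $G/D$ has order $p^2$ and exponent $p$,
  there are $x, y$ with $G = \langle x, y, D \rangle$; put $s = [x,y]$. Everything rests on one
  principle (\<open>commutators_of_generators\<close>): modulo a normal subgroup, two generated subgroups commute
  as soon as their generators do. It turns statements about all commutators into statements about
  a few of them.

  Modulo $N$ the group has class at most $2$, so $D = \langle s, N \rangle$; moreover
  $[x,y]^p \equiv [x^p,y] \equiv 1$ modulo $N$ because $x^p \in D$. Hence $|D| \le p\,|N|$. If
  $\gamma_4(G) = 1$ and $G$ is metabelian, then in the same way $N$ is generated by the central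
  elements $[s,x]$ and $[s,y]$, whose $p$-th powers are trivial, so $|N| \le p^2$. Therefore
  $|G| = p^2 |D| \le p^5$, and a coclass of at least $2$ forces $|G| = p^5$ and $|N| = p^2$.

  For $p = 2$ this cannot happen: some generator has a square outside $N$, and then that square
  and $s$ agree up to a central factor, so the commutator of $s$ with this generator vanishes and
  $|N| \le 2$.

  A maximal subgroup $M$ contains $D$ because $G$ is nilpotent, and $M = \langle u, D \rangle$ for
  some $u$ because $|G : D| = p^2$. In class $3$ its derived subgroup lies in
  $\langle [s,u] \rangle$, which has at most $p < |N|$ elements; in class $2$ it is trivial, while
  $D$ is not. So the last nontrivial term of the lower central series, which is the kernel of the
  projection onto the parent, is never contained in $M'$: polarization is total.

  In class $2$ and coclass $1$ the order is $p^3$. The centre contains $D$; were it larger, it would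
  have index $p$, and together with any further element it would generate an abelian group that is
  all of $G$. So the centre is $D$, of order $p$.
\<close>

section \<open>Commutators modulo a normal subgroup\<close>

definition commutator :: "('a, 'b) monoid_scheme \<Rightarrow> 'a \<Rightarrow> 'a \<Rightarrow> 'a" where
  "commutator G x y = x \<otimes>\<^bsub>G\<^esub> y \<otimes>\<^bsub>G\<^esub> inv\<^bsub>G\<^esub> x \<otimes>\<^bsub>G\<^esub> inv\<^bsub>G\<^esub> y"

lemma (in group_hom) hom_commutator:
  "\<lbrakk>x \<in> carrier G; y \<in> carrier G\<rbrakk> \<Longrightarrow> h (commutator G x y) = commutator H (h x) (h y)"
  by (simp add: commutator_def)

context group
begin

lemma inv_mult_cancel: "\<lbrakk>x \<in> carrier G; y \<in> carrier G\<rbrakk> \<Longrightarrow> inv x \<otimes> (x \<otimes> y) = y"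
  by (simp flip: m_assoc)

lemma mult_inv_cancel: "\<lbrakk>x \<in> carrier G; y \<in> carrier G\<rbrakk> \<Longrightarrow> x \<otimes> (inv x \<otimes> y) = y"
  by (simp flip: m_assoc)

lemmas group_word_simps = m_assoc inv_mult_group inv_mult_cancel mult_inv_cancel

lemma commutator_closed [simp]:
  "\<lbrakk>x \<in> carrier G; y \<in> carrier G\<rbrakk> \<Longrightarrow> commutator G x y \<in> carrier G"
  by (simp add: commutator_def)

lemma inv_commutator:
  "\<lbrakk>x \<in> carrier G; y \<in> carrier G\<rbrakk> \<Longrightarrow> inv (commutator G x y) = commutator G y x"
  by (simp add: commutator_def group_word_simps)

lemma commutator_mult:
  assumes "x \<in> carrier G" "y \<in> carrier G"
  shows "commutator G x y \<otimes> (y \<otimes> x) = x \<otimes> y"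
  using assms by (simp add: commutator_def group_word_simps)

lemma commutator_eq_one_iff:
  assumes "x \<in> carrier G" "y \<in> carrier G"
  shows "commutator G x y = \<one> \<longleftrightarrow> x \<otimes> y = y \<otimes> x"
proof -
  have "x \<otimes> y = y \<otimes> x" if "commutator G x y = \<one>"
    using commutator_mult[OF assms] that assms by simp
  moreover have "commutator G x y = \<one>" if "x \<otimes> y = y \<otimes> x"
    using that assms by (simp add: commutator_def group_word_simps)
  ultimately show ?thesis by blast
qed

lemma commutator_mem_swap:
  assumes "subgroup T G" "x \<in> carrier G" "y \<in> carrier G" "commutator G x y \<in> T"
  shows "commutator G y x \<in> T"
  using assms by (metis inv_commutator subgroup.m_inv_closed)

lemma commutator_mem_normal:
  assumes "N \<lhd> G" "x \<in> N" "y \<in> carrier G"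
  shows "commutator G x y \<in> N" "commutator G y x \<in> N"
proof -
  interpret normal N G by fact
  have x: "x \<in> carrier G" using assms by auto
  have "x \<otimes> (y \<otimes> inv x \<otimes> inv y) \<in> N" using assms inv_op_closed2[of y "inv x"] by auto
  thus "commutator G x y \<in> N" using x assms by (simp add: commutator_def m_assoc)
  thus "commutator G y x \<in> N" using x assms commutator_mem_swap subgroup_axioms by blast
qed

text \<open>The set is the preimage of the centralizer of the coset of \<open>c\<close> in the quotient by \<open>T\<close>.\<close>
lemma subgroup_centralizer_mod:
  assumes "T \<lhd> G" "c \<in> carrier G"
  shows "subgroup {a \<in> carrier G. commutator G a c \<in> T} G"
proof -
  interpret normal T G by fact
  show ?thesis
  proof
    fix a assume a: "a \<in> {a \<in> carrier G. commutator G a c \<in> T}"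
    have "inv a \<otimes> commutator G c a \<otimes> a \<in> T"
      using a assms(2) inv_op_closed1 commutator_mem_swap[OF subgroup_axioms] by blast
    moreover have "inv a \<otimes> commutator G c a \<otimes> a = commutator G (inv a) c"
      using a assms(2) by (simp add: commutator_def group_word_simps)
    ultimately show "inv a \<in> {a \<in> carrier G. commutator G a c \<in> T}" using a by auto
  next
    fix a b assume ab: "a \<in> {a \<in> carrier G. commutator G a c \<in> T}"
      "b \<in> {a \<in> carrier G. commutator G a c \<in> T}"
    have "(a \<otimes> commutator G b c \<otimes> inv a) \<otimes> commutator G a c \<in> T"
      using ab inv_op_closed2 by auto
    moreover have "(a \<otimes> commutator G b c \<otimes> inv a) \<otimes> commutator G a c = commutator G (a \<otimes> b) c"
      using ab assms(2) by (simp add: commutator_def group_word_simps)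
    ultimately show "a \<otimes> b \<in> {a \<in> carrier G. commutator G a c \<in> T}" using ab by auto
  qed (use assms(2) in \<open>auto simp: commutator_def\<close>)
qed

text \<open>
  Centralizers modulo \<open>T\<close> are subgroups: this extends the hypothesis first from \<open>A\<close> to the subgroup
  it generates, with \<open>b\<close> fixed, and then from \<open>B\<close> to the subgroup it generates.
\<close>
lemma commutators_of_generators:
  assumes T: "T \<lhd> G" and A: "A \<subseteq> carrier G" and B: "B \<subseteq> carrier G"
    and AB: "\<And>a b. \<lbrakk>a \<in> A; b \<in> B\<rbrakk> \<Longrightarrow> commutator G a b \<in> T"
    and g: "g \<in> generate G A" and h: "h \<in> generate G B"
  shows "commutator G g h \<in> T"
proof -
  interpret normal T G by fact
  have gc: "g \<in> carrier G" and hc: "h \<in> carrier G"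
    using g h A B generate_in_carrier by blast+
  have *: "commutator G g b \<in> T" if "b \<in> B" for b
  proof -
    have "generate G A \<subseteq> {a \<in> carrier G. commutator G a b \<in> T}"
      using A B AB that by (intro generate_subgroup_incl subgroup_centralizer_mod T) auto
    thus ?thesis using g by auto
  qed
  have "generate G B \<subseteq> {b \<in> carrier G. commutator G b g \<in> T}"
    using B gc * commutator_mem_swap[OF subgroup_axioms gc]
    by (intro generate_subgroup_incl subgroup_centralizer_mod T) auto
  thus ?thesis using h hc gc commutator_mem_swap[OF subgroup_axioms hc gc] by auto
qed

lemma commutator_subgroup_subset_iff:
  assumes "subgroup T G"
  shows "commutator_subgroup G H K \<subseteq> T \<longleftrightarrow> (\<forall>h\<in>H. \<forall>k\<in>K. commutator G h k \<in> T)"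
proof
  assume "commutator_subgroup G H K \<subseteq> T"
  thus "\<forall>h\<in>H. \<forall>k\<in>K. commutator G h k \<in> T"
    unfolding commutator_subgroup_def commutator_def by (blast intro: generate.incl)
next
  assume "\<forall>h\<in>H. \<forall>k\<in>K. commutator G h k \<in> T"
  thus "commutator_subgroup G H K \<subseteq> T"
    unfolding commutator_subgroup_def commutator_def
    by (intro generate_subgroup_incl[OF _ assms]) auto
qed

lemma derived_eq_commutator_subgroup: "derived G H = commutator_subgroup G H H"
  unfolding derived_def commutator_subgroup_def by (rule arg_cong[where f = "generate G"]) blast

lemma derived_subset_iff:
  assumes "subgroup T G"
  shows "derived G H \<subseteq> T \<longleftrightarrow> (\<forall>h\<in>H. \<forall>k\<in>H. commutator G h k \<in> T)"
  unfolding derived_eq_commutator_subgroup by (rule commutator_subgroup_subset_iff[OF assms])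

section \<open>The lower central series and maximal subgroups\<close>

lemma commutator_subgroup_normal:
  assumes "H \<lhd> G" "K \<lhd> G"
  shows "commutator_subgroup G H K \<lhd> G"
proof -
  interpret H: normal H G by fact
  interpret K: normal K G by fact
  have "commutator_subgroup G H K = generate G {commutator G h k | h k. h \<in> H \<and> k \<in> K}"
    unfolding commutator_subgroup_def commutator_def ..
  also have "\<dots> \<lhd> G"
  proof (rule normal_generateI)
    fix c g assume "c \<in> {commutator G h k | h k. h \<in> H \<and> k \<in> K}" and g: "g \<in> carrier G"
    then obtain h k where hk: "h \<in> H" "k \<in> K" "c = commutator G h k" by auto
    have "g \<otimes> c \<otimes> inv g = commutator G (g \<otimes> h \<otimes> inv g) (g \<otimes> k \<otimes> inv g)"
      using g hk H.mem_carrier K.mem_carrier by (simp add: commutator_def group_word_simps)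
    thus "g \<otimes> c \<otimes> inv g \<in> {commutator G h k | h k. h \<in> H \<and> k \<in> K}"
      using g hk H.inv_op_closed2 K.inv_op_closed2 by blast
  qed auto
  finally show ?thesis .
qed

lemma lower_central_normal: "lower_central G i \<lhd> G"
proof (induction i)
  case (Suc i)
  thus ?case
    by (cases i) (auto simp: normal_self commutator_subgroup_normal)
qed (simp add: normal_self)

lemma lower_central_commutator:
  "\<lbrakk>i > 0; h \<in> lower_central G i; k \<in> carrier G\<rbrakk> \<Longrightarrow> commutator G h k \<in> lower_central G (Suc i)"
  using commutator_subgroup_subset_iff[OF normal_imp_subgroup[OF lower_central_normal[of "Suc i"]],
      of "lower_central G i" "carrier G"]
  by (cases i) auto

lemma lower_central_Suc_subset_iff:
  assumes "subgroup T G" "i > 0"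
  shows "lower_central G (Suc i) \<subseteq> T \<longleftrightarrow>
    (\<forall>h\<in>lower_central G i. \<forall>k\<in>carrier G. commutator G h k \<in> T)"
  using assms commutator_subgroup_subset_iff by (cases i) auto

lemma lower_central_Suc_subset: "lower_central G (Suc i) \<subseteq> lower_central G i"
proof (cases i)
  case 0
  thus ?thesis by simp
next
  case (Suc j)
  thus ?thesis
    using lower_central_Suc_subset_iff[of "lower_central G i" i] lower_central_normal
      commutator_mem_normal normal_imp_subgroup by blast
qed

lemma lower_central_2: "lower_central G 2 = derived G (carrier G)"
  by (simp add: numeral_2_eq_2 derived_eq_commutator_subgroup)

text \<open>
  This makes every subgroup between $\gamma_{i+1}(G)$ and $\gamma_i(G)$ normal, which is how the
  subgroups $\langle s, N \rangle$ and the subgroups of the centre become available as moduli.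
\<close>
lemma normal_if_central_mod:
  assumes T: "subgroup T G" and c: "\<And>t g. \<lbrakk>t \<in> T; g \<in> carrier G\<rbrakk> \<Longrightarrow> commutator G t g \<in> T"
  shows "T \<lhd> G"
  unfolding normal_inv_iff
proof (intro conjI ballI T)
  fix g t assume gt: "g \<in> carrier G" "t \<in> T"
  hence tc: "t \<in> carrier G" using subgroup.mem_carrier[OF T] by simp
  have "commutator G g t \<otimes> t \<in> T"
    using gt by (intro subgroup.m_closed[OF T] commutator_mem_swap[OF T tc] c)
  thus "g \<otimes> t \<otimes> inv g \<in> T" using gt tc by (simp add: commutator_def m_assoc)
qed

text \<open>
  Let $L = \gamma_i(G)$ be the last term of the lower central series that is not contained in $M$.
  Then $[L,G] \subseteq M$, so $L$ normalizes $M$, and $\langle M, L \rangle = G$ by maximality. Hence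
  $M$ is normal, and modulo $M$ the group is generated by the image of $L$, whose elements commute.
\<close>
lemma maximal_subgroup_contains_derived:
  assumes nil: "lower_central G (Suc c) = {\<one>}" and M: "M \<in> maximal_subgroups G"
  shows "derived G (carrier G) \<subseteq> M"
proof -
  have sM: "subgroup M G" and ne: "M \<noteq> carrier G"
    and mx: "\<And>H. \<lbrakk>subgroup H G; M \<subseteq> H\<rbrakk> \<Longrightarrow> H = M \<or> H = carrier G"
    using M by (auto simp: maximal_subgroups_def)
  interpret M: subgroup M G by fact
  have "\<not> lower_central G 1 \<subseteq> M" using ne M.subset by auto
  moreover have "lower_central G (Suc c) \<subseteq> M" using nil by auto
  ultimately obtain i where i: "i > 0" "\<not> lower_central G i \<subseteq> M" "lower_central G (Suc i) \<subseteq> M"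
    using nat_induct_non_zero[of "Suc c" "\<lambda>i. \<not> lower_central G i \<subseteq> M"] by auto
  let ?L = "lower_central G i"
  interpret L: normal ?L G by (rule lower_central_normal)
  have LM: "commutator G z g \<in> M" if "z \<in> ?L" "g \<in> carrier G" for z g
    using lower_central_commutator i that by blast
  have gen: "generate G (M \<union> ?L) = carrier G"
    using mx[OF generate_is_subgroup[of "M \<union> ?L"]] i(2) M.subset L.subset
      generate.incl[of _ "M \<union> ?L" G] by blast
  have zm: "z \<otimes> m \<otimes> inv z \<in> M" if "z \<in> ?L" "m \<in> M" for z m
  proof -
    have "commutator G z m \<otimes> m \<in> M" using LM[of z m] that by simp
    thus ?thesis using that by (simp add: commutator_def m_assoc)
  qed
  have M: "M \<lhd> G"
  proof -
    \<comment> \<open>Asking for both conjugates makes the set closed under inverses even if $M$ is infinite.\<close>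
    let ?N = "{g \<in> carrier G. \<forall>m\<in>M. g \<otimes> m \<otimes> inv g \<in> M \<and> inv g \<otimes> m \<otimes> g \<in> M}"
    have "subgroup ?N G"
    proof
      fix g h assume "g \<in> ?N" "h \<in> ?N"
      moreover have "g \<otimes> h \<otimes> m \<otimes> inv (g \<otimes> h) = g \<otimes> (h \<otimes> m \<otimes> inv h) \<otimes> inv g"
        "inv (g \<otimes> h) \<otimes> m \<otimes> (g \<otimes> h) = inv h \<otimes> (inv g \<otimes> m \<otimes> g) \<otimes> h"
        if "g \<in> carrier G" "h \<in> carrier G" "m \<in> M" for m
        using that by (simp_all add: group_word_simps)
      ultimately show "g \<otimes> h \<in> ?N" by simp
    qed auto
    moreover have "M \<union> ?L \<subseteq> ?N"
    proof
      fix g assume g: "g \<in> M \<union> ?L"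
      hence gc: "g \<in> carrier G" using M.subset L.subset by blast
      have "g \<otimes> m \<otimes> inv g \<in> M \<and> inv g \<otimes> m \<otimes> g \<in> M" if m: "m \<in> M" for m
      proof (cases "g \<in> M")
        case True
        thus ?thesis by (intro conjI M.m_closed M.m_inv_closed m)
      next
        case False
        hence "g \<in> ?L" using g by blast
        thus ?thesis using zm[OF _ m, of g] zm[OF L.m_inv_closed m, of g] inv_inv[OF gc] by metis
      qed
      thus "g \<in> ?N" using gc by blast
    qed
    ultimately have "carrier G \<subseteq> ?N"
      using generate_subgroup_incl[of "M \<union> ?L" ?N] gen by simp
    thus ?thesis unfolding normal_inv_iff using sM by blast
  qed
  have "commutator G g h \<in> M" if "g \<in> carrier G" "h \<in> carrier G" for g h
  proof (rule commutators_of_generators[OF M, of "M \<union> ?L" "M \<union> ?L"])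
    fix a b assume a: "a \<in> M \<union> ?L" and "b \<in> M \<union> ?L"
    hence b: "b \<in> carrier G" using M.subset L.subset by blast
    show "commutator G a b \<in> M"
      using a commutator_mem_normal(1)[OF M _ b] LM[OF _ b] by (elim UnE)
  qed (use that gen M.subset L.subset in simp_all)
  thus ?thesis using derived_subset_iff[OF sM] by blast
qed

section \<open>Powers of commutators and indices of subgroups\<close>

lemma commutator_mem_if_cosets_commute:
  assumes "N \<lhd> G" "x \<in> carrier G" "y \<in> carrier G" "N #> (x \<otimes> y) = N #> (y \<otimes> x)"
  shows "commutator G x y \<in> N"
proof -
  interpret normal N G by fact
  have "x \<otimes> y \<in> N #> (y \<otimes> x)"
    using rcos_self[OF _ subgroup_axioms, of "x \<otimes> y"] assms by simp
  then obtain n where n: "n \<in> N" "x \<otimes> y = n \<otimes> (y \<otimes> x)"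
    unfolding r_coset_def by auto
  have "commutator G x y = (x \<otimes> y) \<otimes> inv (y \<otimes> x)"
    using assms by (simp add: commutator_def group_word_simps)
  also have "\<dots> = n"
    unfolding n(2) using n(1) assms by (simp add: m_assoc)
  finally show ?thesis using n(1) by simp
qed

lemma pow_commutator:
  assumes "x \<in> carrier G" "y \<in> carrier G"
    and "commutator G x y \<otimes> x = x \<otimes> commutator G x y"
  shows "commutator G (x [^] (k::nat)) y = commutator G x y [^] k"
proof (induction k)
  case 0
  show ?case using assms by (simp add: commutator_def)
next
  case (Suc k)
  let ?s = "commutator G x y"
  have s: "?s \<in> carrier G" using assms by simp
  have "commutator G (x [^] Suc k) y = x [^] k \<otimes> ?s \<otimes> inv (x [^] k) \<otimes> commutator G (x [^] k) y"
    using assms by (simp add: commutator_def group_word_simps)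
  also have "x [^] k \<otimes> ?s = ?s \<otimes> x [^] k"
    using group_commutes_pow[OF assms(3)[symmetric] assms(1) s] .
  finally have "commutator G (x [^] Suc k) y = ?s \<otimes> ?s [^] k"
    using assms(1) s Suc by (simp add: m_assoc)
  thus ?case using nat_pow_Suc2[OF s] by simp
qed

text \<open>
  In the quotient by \<open>N\<close> the commutator of \<open>x\<close> and \<open>y\<close> commutes with \<open>x\<close>, so there
  \<open>pow_commutator\<close> gives $[x,y]^k = [x^k,y] = 1$. This bounds the order of a commutator modulo the
  next term of the lower central series.
\<close>
lemma pow_commutator_mem:
  assumes N: "N \<lhd> G" and x: "x \<in> carrier G" and y: "y \<in> carrier G"
    and c: "commutator G (commutator G x y) x \<in> N" and k: "commutator G (x [^] (k::nat)) y \<in> N"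
  shows "commutator G x y [^] k \<in> N"
proof -
  interpret normal N G by fact
  interpret Q: group "G Mod N" by (rule factorgroup_is_group)
  define f where "f = r_coset G N"
  interpret f: group_hom G "G Mod N" f
    by unfold_locales (use r_coset_hom_Mod in \<open>simp add: f_def\<close>)
  have ker: "f a = \<one>\<^bsub>G Mod N\<^esub> \<longleftrightarrow> a \<in> N" if "a \<in> carrier G" for a
    using that coset_join1[OF _ _ subgroup_axioms] coset_join2[OF _ subgroup_axioms]
    by (auto simp: f_def)
  have fx: "f x \<in> carrier (G Mod N)" and fy: "f y \<in> carrier (G Mod N)" using x y by simp_all
  have "commutator (G Mod N) (commutator (G Mod N) (f x) (f y)) (f x) = \<one>\<^bsub>G Mod N\<^esub>"
    using c ker x y by (simp del: one_FactGroup mult_FactGroup flip: f.hom_commutator)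
  hence "commutator (G Mod N) (f x) (f y) [^]\<^bsub>G Mod N\<^esub> k = commutator (G Mod N) (f x [^]\<^bsub>G Mod N\<^esub> k) (f y)"
    using Q.pow_commutator[OF fx fy] Q.commutator_eq_one_iff[OF Q.commutator_closed[OF fx fy] fx]
    by (simp del: one_FactGroup mult_FactGroup)
  hence "f (commutator G x y [^] k) = f (commutator G (x [^] k) y)"
    using x y by (simp del: one_FactGroup mult_FactGroup add: f.hom_commutator f.hom_nat_pow)
  thus ?thesis using ker[of "commutator G (x [^] k) y"] ker[of "commutator G x y [^] k"] k x y
    by simp
qed

text \<open>
  The elements $g$ for which some integer power $s^k$ has $g s^k \in N$ form a subgroup
  because $N$ is normal; the exponent only matters modulo $p$ because $s^p \in N$.
\<close>
lemma generate_insert_subset: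
  assumes N: "N \<lhd> G" and s: "s \<in> carrier G" and p: "p > 0" "s [^] (p::nat) \<in> N"
  shows "generate G (insert s N) \<subseteq> (\<Union>i<p. N #> s [^] i)"
proof -
  interpret normal N G by fact
  let ?S = "{g \<in> carrier G. \<exists>k::int. g \<otimes> s [^] k \<in> N}"
  have "subgroup ?S G"
  proof
    show "\<one> \<in> ?S" using s by (auto intro!: exI[of _ 0])
  next
    fix g assume "g \<in> ?S"
    then obtain k :: int where g: "g \<in> carrier G" "g \<otimes> s [^] k \<in> N" by auto
    have "s [^] k \<otimes> inv (g \<otimes> s [^] k) \<otimes> inv (s [^] k) \<in> N"
      using g s inv_op_closed2 by simp
    moreover have "s [^] k \<otimes> inv (g \<otimes> s [^] k) \<otimes> inv (s [^] k) = inv g \<otimes> s [^] (- k)"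
      using g s by (simp add: group_word_simps int_pow_neg)
    ultimately show "inv g \<in> ?S" using g(1) by auto
  next
    fix g h assume "g \<in> ?S" "h \<in> ?S"
    then obtain k l :: int where gh: "g \<in> carrier G" "g \<otimes> s [^] k \<in> N"
      "h \<in> carrier G" "h \<otimes> s [^] l \<in> N" by auto
    have "(g \<otimes> (h \<otimes> s [^] l) \<otimes> inv g) \<otimes> (g \<otimes> s [^] k) \<in> N"
      using gh inv_op_closed2 by blast
    moreover have "(g \<otimes> (h \<otimes> s [^] l) \<otimes> inv g) \<otimes> (g \<otimes> s [^] k) = g \<otimes> h \<otimes> s [^] (l + k)"
      using gh s by (simp add: group_word_simps int_pow_mult)
    ultimately show "g \<otimes> h \<in> ?S" using gh by auto
  qed auto
  moreover have "insert s N \<subseteq> ?S"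
  proof -
    have "s \<otimes> s [^] (-1::int) \<in> N" using s by (simp add: int_pow_neg)
    moreover have "n \<otimes> s [^] (0::int) \<in> N" if "n \<in> N" for n using that by simp
    ultimately show ?thesis using s mem_carrier by blast
  qed
  ultimately have "generate G (insert s N) \<subseteq> ?S" by (intro generate_subgroup_incl)
  also have "\<dots> \<subseteq> (\<Union>i<p. N #> s [^] i)"
  proof
    fix g assume "g \<in> ?S"
    then obtain k :: int where g: "g \<in> carrier G" "g \<otimes> s [^] k \<in> N" by auto
    \<comment> \<open>$g$ lies in $N s^{-k}$; reduce the exponent $-k$ modulo $p$.\<close>
    define i where "i = nat ((- k) mod int p)"
    have i: "i < p" "int i = (- k) mod int p" using p by (auto simp: i_def nat_less_iff)
    have *: "- int i = k + int p * ((- k) div int p)"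
      using i(2) mult_div_mod_eq[of "int p" "- k"] by linarith
    have "s [^] (int p * ((- k) div int p)) = (s [^] p) [^] ((- k) div int p)"
      using s by (simp add: int_pow_int flip: int_pow_pow)
    also have "\<dots> \<in> N" using p(2) subgroup_int_pow_closed subgroup_axioms by blast
    finally have "(g \<otimes> s [^] k) \<otimes> s [^] (int p * ((- k) div int p)) \<in> N" using g by blast
    hence n: "g \<otimes> inv (s [^] i) \<in> N"
      using g(1) s by (simp add: m_assoc int_pow_mult[symmetric] *[symmetric] int_pow_neg int_pow_int)
    have "g = (g \<otimes> inv (s [^] i)) \<otimes> s [^] i" using g s by (simp add: m_assoc)
    hence "g \<in> N #> s [^] i" unfolding r_coset_def using n by blast
    thus "g \<in> (\<Union>i<p. N #> s [^] i)" using i by blast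
  qed
  finally show ?thesis .
qed

lemma card_generate_insert_le:
  assumes "finite (carrier G)" "N \<lhd> G" "s \<in> carrier G" "p > 0" "s [^] (p::nat) \<in> N"
  shows "card (generate G (insert s N)) \<le> p * card N"
proof -
  interpret normal N G by fact
  have fin: "finite (N #> s [^] i)" for i :: nat
    using finite_subset[OF r_coset_subset_G assms(1)] subset assms(3) by simp
  have "card (generate G (insert s N)) \<le> card (\<Union>i<p. N #> s [^] i)"
    using generate_insert_subset[OF assms(2-5)] fin by (intro card_mono) auto
  also have "\<dots> \<le> (\<Sum>i<p. card (N #> s [^] i))"
    by (rule card_UN_le) simp
  also have "\<dots> = (\<Sum>i<p. card N)"
    using assms subset by (intro sum.cong refl card_rcosets_equal[symmetric]) (auto simp: RCOSETS_def)
  finally show ?thesis by simp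
qed

lemma card_subgroup_dvd_card_subgroup:
  assumes "subgroup K G" "subgroup H G" "K \<subseteq> H"
  shows "card K dvd card H"
proof -
  interpret H: group "G\<lparr>carrier := H\<rparr>" by (rule subgroup_imp_group) fact
  have "subgroup K (G\<lparr>carrier := H\<rparr>)" by (rule subgroup_incl) fact+
  from H.lagrange[OF this] show ?thesis
    by (simp add: order_def dvd_def) (metis mult.commute)
qed

text \<open>
  Each proper inclusion of subgroups above \<open>A\<close> uses up at least one factor \<open>p\<close> of the index
  $p^2$, so two of them reach the whole group.
\<close>
lemma chain_above_index_prime_square:
  assumes p: "Factorial_Ring.prime p" and fin: "finite (carrier G)"
    and A: "subgroup A G" "order G = p ^ 2 * card A"
    and K: "subgroup K G" "A \<subset> K" and H: "subgroup H G" "K \<subset> H"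
  shows "H = carrier G"
proof -
  have fH: "finite H" using H(1) fin finite_subset subgroup.subset by blast
  have fK: "finite K" using H(2) fH finite_subset by blast
  have "finite A" using K(2) fK finite_subset by blast
  hence cA: "card A > 0" using subgroup.one_closed[OF A(1)] card_gt_0_iff by blast
  obtain a where a: "card K = card A * a"
    using card_subgroup_dvd_card_subgroup[OF A(1) K(1)] K(2) by (auto elim!: dvdE)
  obtain b where b: "card H = card K * b"
    using card_subgroup_dvd_card_subgroup[OF K(1) H(1)] H(2) by (auto elim!: dvdE)
  obtain c where c: "order G = card H * c"
    using card_subgroup_dvd_card_subgroup[OF H(1) subgroup_self] subgroup.subset[OF H(1)]
    by (auto simp: order_def elim!: dvdE)
  have abc: "a * b * c = p ^ 2" using a b c A(2) cA by (simp add: algebra_simps)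
  have "card A < card K" "card K < card H" using psubset_card_mono K(2) H(2) fK fH by auto
  hence ab: "a \<noteq> 1" "b \<noteq> 1" using a b by auto
  have ge: "p \<le> d" if d: "d dvd p ^ 2" "d \<noteq> 1" for d
  proof -
    obtain i where i: "d = p ^ i" using d(1) divides_primepow_nat[OF p] by auto
    hence "i \<noteq> 0" using d(2) by auto
    thus ?thesis using i self_le_power[of p i] prime_gt_0_nat[OF p] by simp
  qed
  have "a dvd p ^ 2" "b dvd p ^ 2" unfolding abc[symmetric] by auto
  hence "p * p \<le> a * b" using ge ab by (intro mult_le_mono) auto
  hence "p * p * c \<le> p * p * 1" using abc mult_le_mono1[of "p * p" "a * b" c] by (simp add: power2_eq_square)
  hence "c \<le> 1" using prime_gt_0_nat[OF p] by simp
  moreover have "c \<noteq> 0" using abc prime_gt_0_nat[OF p] by (intro notI) simp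
  ultimately have "card H = card (carrier G)" using c by (simp add: order_def)
  thus ?thesis using fin subgroup.subset[OF H(1)] card_subset_eq by blast
qed

end

section \<open>Finite $p$-groups are nilpotent\<close>

text \<open>
  The class equation: were the centre trivial, every conjugacy class other than that of the identity
  would have a size divisible by $p$, and so would the number $p^n - 1$ of nonidentity elements.
\<close>
lemma (in group) p_group_nontrivial_center:
  assumes p: "Factorial_Ring.prime p" and G: "p_group p G" "order G \<noteq> 1"
  shows "\<exists>z \<in> group_center G. z \<noteq> \<one>"
proof (rule ccontr)
  assume "\<not> ?thesis"
  moreover have "\<one> \<in> group_center G" by (auto simp: group_center_def)
  ultimately have Z: "group_center G = {\<one>}" by blast
  obtain n where n: "order G = p ^ n" and fin: "finite (carrier G)" using G by (auto simp: p_group_def)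
  define \<phi> where "\<phi> = (\<lambda>g. \<lambda>h\<in>carrier G. g \<otimes> h \<otimes> inv g)"
  interpret group_action G "carrier G" \<phi>
    unfolding \<phi>_def by (rule action_by_conjugation)
  define Orb where "Orb = orbits G (carrier G) \<phi>"
  let ?C = "Orb - {{\<one>}}"
  have one: "orbit G \<phi> \<one> = {\<one>}"
    unfolding orbit_def by (auto simp: \<phi>_def intro!: exI[of _ \<one>])
  have disj: "c1 \<inter> c2 = {}" if "c1 \<in> Orb" "c2 \<in> Orb" "c1 \<noteq> c2" for c1 c2
    using disjoint_union[of c1 c2] that by (simp add: Orb_def)
  have one_Orb: "{\<one>} \<in> Orb" unfolding Orb_def orbits_def using one[symmetric] one_closed by blast
  have "\<Union>Orb = carrier G" unfolding Orb_def by (rule orbits_coverture)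
  hence un: "\<Union>?C = carrier G - {\<one>}"
    using disj[OF one_Orb] by blast
  have "p dvd card (\<Union>?C)"
  proof (rule dvd_partition)
    show "finite (\<Union>?C)" using un fin by simp
    show "\<forall>c\<in>?C. p dvd card c"
    proof
      fix c assume c: "c \<in> ?C"
      then obtain x where x: "x \<in> carrier G" "c = orbit G \<phi> x"
        unfolding Orb_def orbits_def by auto
      have "card c dvd p ^ n"
        using orbit_stabilizer_theorem[OF x(1)] n x(2) by (metis dvd_triv_left)
      then obtain i where i: "card c = p ^ i" using divides_primepow_nat[OF p] by auto
      have "i \<noteq> 0"
      proof
        assume "i = 0"
        hence "card c = 1" using i by simp
        then obtain y where y: "c = {y}" by (rule card_1_singletonE)
        have "x \<in> c" using orbit_refl x by simp
        hence cx: "c = {x}" using y by simp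
        have "g \<otimes> x \<otimes> inv g = x" if g: "g \<in> carrier G" for g
        proof -
          have "\<phi> g x \<in> c" unfolding x(2) orbit_def using g by blast
          thus ?thesis using cx x(1) by (simp add: \<phi>_def)
        qed
        hence "x \<otimes> g = g \<otimes> x" if "g \<in> carrier G" for g
          using that x(1) inv_solve_right[of x "g \<otimes> x" g] by (metis m_closed)
        hence "x \<in> group_center G" using x by (simp add: group_center_def)
        thus False using Z cx c by simp
      qed
      thus "p dvd card c" using i by simp
    qed
    show "\<forall>c1\<in>?C. \<forall>c2\<in>?C. c1 \<noteq> c2 \<longrightarrow> c1 \<inter> c2 = {}" using disj by simp
  qed
  hence "p dvd p ^ n - 1" using un fin n by (simp add: order_def)
  moreover have "p dvd p ^ n" using G n by (cases n) auto
  moreover have "p ^ n > 0" using p prime_gt_0_nat by simp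
  ultimately have "p dvd 1"
    using dvd_diffD1 by (metis One_nat_def Suc_leI)
  thus False using p not_prime_unit by blast
qed

lemma (in group) p_group_quotient:
  assumes "Factorial_Ring.prime p" "p_group p G" "N \<lhd> G"
  shows "p_group p (G Mod N)"
proof -
  interpret normal N G by fact
  obtain n where n: "order G = p ^ n" and fin: "finite (carrier G)" using assms by (auto simp: p_group_def)
  have "order (G Mod N) dvd p ^ n"
    using lagrange[OF subgroup_axioms] n by (metis dvd_triv_left order_def FactGroup_def partial_object.select_convs(1))
  thus ?thesis
    using assms(1) divides_primepow_nat fin factorgroup_is_group
    by (auto simp: p_group_def carrier_FactGroup)
qed

text \<open>
  Induction on $|G| - |N|$: if $zN$ is a nontrivial element of the centre of $G/N$ and
  $K = \langle z, N \rangle$, then $\gamma_i(G) \subseteq K$ for some $i$ by induction, hence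
  $\gamma_{i+1}(G) \subseteq [K,G] \subseteq N$. Working with the normal subgroups of one group keeps
  the induction within a single type, which an induction over quotient groups would leave.
\<close>
lemma (in group) p_group_lower_central_subset:
  assumes p: "Factorial_Ring.prime p" and G: "p_group p G"
  shows "N \<lhd> G \<Longrightarrow> \<exists>i. lower_central G (Suc i) \<subseteq> N"
proof (induction "order G - card N" arbitrary: N rule: less_induct)
  case less
  interpret normal N G by fact
  have fin: "finite (carrier G)" using G by (simp add: p_group_def)
  show ?case
  proof (cases "N = carrier G")
    case True
    thus ?thesis by (intro exI[of _ 0]) simp
  next
    case False
    interpret Q: group "G Mod N" by (rule factorgroup_is_group)
    have "order (G Mod N) \<noteq> 1"
    proof
      assume "order (G Mod N) = 1"
      hence "card N = card (carrier G)"
        using lagrange[OF subgroup_axioms] by (simp add: order_def FactGroup_def)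
      thus False using False fin subset card_subset_eq by blast
    qed
    then obtain Z where Z: "Z \<in> group_center (G Mod N)" "Z \<noteq> N"
      using Q.p_group_nontrivial_center[OF p p_group_quotient[OF p G less.prems]] by auto
    then obtain z where z: "z \<in> carrier G" "Z = N #> z"
      by (auto simp: group_center_def carrier_FactGroup)
    have zN: "z \<notin> N" using Z z coset_join2 subgroup_axioms by blast
    let ?K = "generate G (insert z N)"
    have zg: "commutator G z g \<in> N" if g: "g \<in> carrier G" for g
    proof (rule commutator_mem_if_cosets_commute[OF less.prems z(1) g])
      have "(N #> z) <#> (N #> g) = (N #> g) <#> (N #> z)"
        using Z g z by (auto simp: group_center_def carrier_FactGroup)
      thus "N #> (z \<otimes> g) = N #> (g \<otimes> z)" using g z by (simp add: rcos_sum)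
    qed
    have KN: "commutator G k g \<in> N" if "k \<in> ?K" "g \<in> carrier G" for k g
    proof (rule commutators_of_generators[OF less.prems _ _ _ that(1), of "carrier G"])
      show "commutator G a b \<in> N" if "a \<in> insert z N" "b \<in> carrier G" for a b
        using that zg commutator_mem_normal(1)[OF less.prems] by blast
      show "g \<in> generate G (carrier G)" using that by (blast intro: generate.incl)
    qed (use z subset in auto)
    have sK: "subgroup ?K G" using generate_is_subgroup z subset by simp
    have NK: "insert z N \<subseteq> ?K" by (blast intro: generate.incl)
    have "?K \<lhd> G" using normal_if_central_mod[OF sK] KN NK by blast
    moreover have "order G - card ?K < order G - card N"
    proof -
      have "finite ?K" using fin finite_subset subgroup.subset[OF sK] by blast
      hence "card N < card ?K" "card ?K \<le> order G"
        using NK zN psubset_card_mono[of ?K N] card_mono[OF fin subgroup.subset[OF sK]]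
        by (auto simp: order_def)
      thus ?thesis by simp
    qed
    ultimately obtain i where "lower_central G (Suc i) \<subseteq> ?K" using less.hyps by blast
    hence "lower_central G (Suc (Suc i)) \<subseteq> N"
      using lower_central_Suc_subset_iff[OF subgroup_axioms, of "Suc i"] KN by blast
    thus ?thesis by blast
  qed
qed

section \<open>The parent projection, the class and the exponent\<close>

lemma (in group) kernel_parent_proj:
  "kernel G (parent G) (parent_proj G) = lower_central G (nilpotency_class G)"
proof -
  interpret L: normal "lower_central G (nilpotency_class G)" G by (rule lower_central_normal)
  show ?thesis
    using coset_join1[OF _ _ L.subgroup_axioms] coset_join2[OF _ L.subgroup_axioms] L.subset
    by (auto simp: kernel_def parent_def parent_proj_def)
qed

lemma (in group) total_polarization:
  assumes "bij_betw U {1..p + 1} (maximal_subgroups G)"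
    and "\<And>M. M \<in> maximal_subgroups G \<Longrightarrow> \<not> lower_central G (nilpotency_class G) \<subseteq> derived G M"
  shows "Pol p G U = {1..p + 1}" "Stb p G U = {}"
proof -
  have "\<not> lower_central G (nilpotency_class G) \<subseteq> derived G (U i)" if "1 \<le> i" "i \<le> p + 1" for i
    using assms that by (metis bij_betwE atLeastAtMost_iff)
  thus "Pol p G U = {1..p + 1}" "Stb p G U = {}"
    by (auto simp: Pol_def Stb_def kernel_parent_proj)
qed

text \<open>Nilpotency of $p$-groups guarantees that the minimum in the definition of the class is
  attained.\<close>
lemma (in group) p_group_nilpotency_class:
  assumes "Factorial_Ring.prime p" "p_group p G"
  shows "lower_central G (Suc (nilpotency_class G)) = {\<one>}"
    and "i < nilpotency_class G \<Longrightarrow> lower_central G (Suc i) \<noteq> {\<one>}"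
proof -
  obtain c where "lower_central G (Suc c) \<subseteq> {\<one>}"
    using p_group_lower_central_subset[OF assms one_is_normal] by blast
  hence "lower_central G (Suc c) = {\<one>}"
    using subgroup.one_closed[OF normal_imp_subgroup[OF lower_central_normal]] by blast
  thus "lower_central G (Suc (nilpotency_class G)) = {\<one>}"
    unfolding nilpotency_class_def by (rule LeastI)
  show "i < nilpotency_class G \<Longrightarrow> lower_central G (Suc i) \<noteq> {\<one>}"
    unfolding nilpotency_class_def by (rule not_less_Least)
qed

text \<open>By minimality of the exponent $m$, the remainder of $p^2$ modulo $m$ must vanish, so $m$
  divides $p^2$.\<close>
lemma (in group) group_exponent_cases:
  assumes p: "Factorial_Ring.prime p" and pow: "\<And>x. x \<in> carrier G \<Longrightarrow> x [^] (p ^ 2) = \<one>"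
    and nt: "carrier G \<noteq> {\<one>}"
  shows "group_exponent G = p \<or> group_exponent G = p ^ 2"
proof -
  let ?P = "\<lambda>m::nat. 0 < m \<and> (\<forall>x\<in>carrier G. x [^] m = \<one>)"
  define m where "m = group_exponent G"
  have m_Least: "m = (LEAST m. ?P m)" by (simp add: m_def group_exponent_def)
  have "?P (p ^ 2)" using pow prime_gt_0_nat[OF p] by simp
  hence m: "?P m" unfolding m_Least by (rule LeastI)
  have "x [^] (p ^ 2 mod m) = \<one>" if x: "x \<in> carrier G" for x
  proof -
    have "x [^] (p ^ 2) = x [^] (m * (p ^ 2 div m)) \<otimes> x [^] (p ^ 2 mod m)"
      using x by (simp add: nat_pow_mult)
    also have "x [^] (m * (p ^ 2 div m)) = \<one>"
      using x m by (simp flip: nat_pow_pow)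
    finally show ?thesis using pow[OF x] x by simp
  qed
  moreover have "\<not> ?P (p ^ 2 mod m)"
    unfolding m_Least using m by (intro not_less_Least) (simp flip: m_Least)
  ultimately have "m dvd p ^ 2" by auto
  then obtain i where i: "i \<le> 2" "m = p ^ i" using divides_primepow_nat[OF p] by blast
  have "i \<noteq> 0"
  proof
    assume "i = 0"
    hence "x = \<one>" if "x \<in> carrier G" for x using m i that by auto
    thus False using nt by auto
  qed
  hence "i = 1 \<or> i = 2" using i by auto
  thus ?thesis using i by (auto simp: m_def)
qed

section \<open>Groups with abelianization of type $(p,p)$\<close>

text \<open>
  The isomorphism type of the abelianization enters only through its order $p^2$ and through its
  exponent dividing $p$.
\<close>
locale abelianization_type_pp = group G for G (structure) +
  fixes p :: nat
  assumes p: "Factorial_Ring.prime p"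
    and p_group: "p_group p G"
    and order_eq: "order G = p ^ 2 * card (derived G (carrier G))"
    and pow_p_mem: "x \<in> carrier G \<Longrightarrow> x [^] p \<in> derived G (carrier G)"

lemma abelianization_type_ppI:
  fixes G (structure)
  assumes p: "Factorial_Ring.prime p" and G: "p_group p G"
    and iso: "abelianization G \<cong> integer_mod_group p \<times>\<times> integer_mod_group p"
  shows "abelianization_type_pp G p"
proof -
  interpret group G using G by (simp add: p_group_def)
  let ?D = "derived G (carrier G)" and ?Z = "integer_mod_group p \<times>\<times> integer_mod_group p"
  interpret D: normal ?D G by (rule derived_self_is_normal)
  interpret Q: group "G Mod ?D" by (rule D.factorgroup_is_group)
  have Z: "group ?Z" by (simp add: DirProd_group)
  obtain f where f: "f \<in> iso (G Mod ?D) ?Z"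
    using iso by (auto simp: is_iso_def abelianization_def)
  interpret f: group_hom "G Mod ?D" ?Z f
    using f Z Q.is_group by (simp add: group_hom_def group_hom_axioms_def iso_def)
  have p0: "p \<noteq> 0" using p by auto
  have "order (G Mod ?D) = order ?Z" using f by (rule iso_same_order)
  also have "\<dots> = p ^ 2"
    using p0 by (simp add: order_def carrier_integer_mod_group card_cartesian_product power2_eq_square)
  finally have "order G = p ^ 2 * card ?D"
    using lagrange[OF D.subgroup_axioms] by (simp add: order_def FactGroup_def)
  moreover have "x [^] p \<in> ?D" if x: "x \<in> carrier G" for x
  proof -
    have X: "?D #> x \<in> carrier (G Mod ?D)" using x by (auto simp: carrier_FactGroup)
    have pow: "z [^]\<^bsub>?Z\<^esub> k = (fst z [^]\<^bsub>integer_mod_group p\<^esub> k, snd z [^]\<^bsub>integer_mod_group p\<^esub> k)"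
      for z and k :: nat
      by (induction k) (simp_all add: mult_DirProd')
    have "f ((?D #> x) [^]\<^bsub>G Mod ?D\<^esub> p) = f (?D #> x) [^]\<^bsub>?Z\<^esub> p"
      using X by (rule f.hom_nat_pow)
    also have "\<dots> = \<one>\<^bsub>?Z\<^esub>" by (simp add: pow)
    also have "\<dots> = f \<one>\<^bsub>G Mod ?D\<^esub>" by (simp only: f.hom_one)
    finally have "(?D #> x) [^]\<^bsub>G Mod ?D\<^esub> p = \<one>\<^bsub>G Mod ?D\<^esub>"
      using f X Q.nat_pow_closed Q.one_closed by (auto simp only: iso_def bij_betw_def inj_on_eq_iff)
    hence "?D #> (x [^] p) = ?D" using D.FactGroup_pow[OF x] by simp
    thus ?thesis using coset_join1[OF _ _ D.subgroup_axioms] x by simp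
  qed
  ultimately show ?thesis
    using p G by unfold_locales
qed

context abelianization_type_pp
begin

text \<open>These are $\gamma_2(G)$ and $\gamma_3(G)$.\<close>
abbreviation "D \<equiv> derived G (carrier G)"
abbreviation "N \<equiv> lower_central G 3"

sublocale D: normal D G by (rule derived_self_is_normal)
sublocale N: normal N G by (rule lower_central_normal)

lemma finite_carrier: "finite (carrier G)" using p_group by (simp add: p_group_def)

lemma p_pos: "p > 0" using prime_gt_0_nat[OF p] .

lemma N_subset_D: "N \<subseteq> D"
  using lower_central_Suc_subset[of 2] lower_central_2 by simp

lemma commutator_in_D: "\<lbrakk>x \<in> carrier G; y \<in> carrier G\<rbrakk> \<Longrightarrow> commutator G x y \<in> D"
  using derived_subset_iff[OF D.subgroup_axioms] by blast

lemma commutator_in_N: "\<lbrakk>x \<in> D; y \<in> carrier G\<rbrakk> \<Longrightarrow> commutator G x y \<in> N"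
  using lower_central_commutator[of 2 x y] lower_central_2 by simp

lemma N_subset_iff:
  "subgroup T G \<Longrightarrow> N \<subseteq> T \<longleftrightarrow> (\<forall>h\<in>D. \<forall>k\<in>carrier G. commutator G h k \<in> T)"
  using lower_central_Suc_subset_iff[of T 2] lower_central_2 by simp

text \<open>The abelianization is not cyclic: $x^p \in D$ leaves at most $p$ cosets of $D$ in
  $\langle x, D \rangle$.\<close>
lemma generate_insert_D_neq:
  assumes "x \<in> carrier G"
  shows "generate G (insert x D) \<noteq> carrier G"
proof
  assume eq: "generate G (insert x D) = carrier G"
  have "card D > 0" using finite_subset[OF D.subset finite_carrier] D.one_closed card_gt_0_iff by blast
  moreover have "p ^ 2 * card D \<le> p * card D"
    using card_generate_insert_le[OF finite_carrier D.normal_axioms assms p_pos pow_p_mem[OF assms]]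
      eq order_eq by (simp add: order_def)
  ultimately show False
    using prime_gt_1_nat[OF p] by (simp add: power2_eq_square)
qed

lemma chain_above_D:
  assumes "subgroup K G" "D \<subset> K" "subgroup H G" "K \<subset> H"
  shows "H = carrier G"
  by (rule chain_above_index_prime_square[OF p finite_carrier D.subgroup_axioms order_eq assms])

lemma subgroup_generate_D: "x \<in> carrier G \<Longrightarrow> subgroup (generate G (insert x D)) G"
  using D.subset by (intro generate_is_subgroup) simp

lemma D_neq_carrier: "D \<noteq> carrier G"
proof
  assume "D = carrier G"
  hence "generate G (insert \<one> D) = carrier G"
    using generate_is_subgroup[of "insert \<one> D"] generate.incl[of _ "insert \<one> D" G]
      subgroup.subset[OF subgroup_generate_D[OF one_closed]] by blast
  thus False using generate_insert_D_neq by blast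
qed

lemma generating_pair:
  obtains x y where "x \<in> carrier G" "y \<in> carrier G" "generate G (insert x (insert y D)) = carrier G"
proof -
  obtain x where x: "x \<in> carrier G" "x \<notin> D"
    using D_neq_carrier D.subset by blast
  let ?K = "generate G (insert x D)"
  have K: "subgroup ?K G" using x(1) by (rule subgroup_generate_D)
  have inK: "insert x D \<subseteq> ?K" by (blast intro: generate.incl)
  obtain y where y: "y \<in> carrier G" "y \<notin> ?K"
    using generate_insert_D_neq[OF x(1)] subgroup.subset[OF K] by blast
  let ?H = "generate G (insert x (insert y D))"
  have c: "insert x (insert y D) \<subseteq> carrier G" using x y D.subset by blast
  have inH: "insert x (insert y D) \<subseteq> ?H" by (blast intro: generate.incl)
  have "?K \<subseteq> ?H" by (rule mono_generate) blast
  hence "?H = carrier G"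
    using chain_above_D[OF K _ generate_is_subgroup[OF c]] inK inH x y by blast
  thus ?thesis using that x y by blast
qed

text \<open>
  A maximal subgroup contains $D$; for $u \in U \setminus D$ a proper inclusion of
  $\langle u, D \rangle$ in $U$ would make $U$ the whole group by \<open>chain_above_D\<close>.
\<close>
lemma maximal_subgroup_generate:
  assumes U: "U \<in> maximal_subgroups G"
  obtains u where "u \<in> carrier G" "U = generate G (insert u D)"
proof -
  have sU: "subgroup U G" and ne: "U \<noteq> carrier G" using U by (auto simp: maximal_subgroups_def)
  obtain c where c: "lower_central G (Suc c) \<subseteq> {\<one>}"
    using p_group_lower_central_subset[OF p p_group one_is_normal] by blast
  hence "lower_central G (Suc c) = {\<one>}"
    using subgroup.one_closed[OF normal_imp_subgroup[OF lower_central_normal]] by blast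
  hence DU: "D \<subseteq> U" by (rule maximal_subgroup_contains_derived[OF _ U])
  have gU: "generate G (insert u D) \<subseteq> U" if "u \<in> U" for u
    using that DU sU by (intro generate_subgroup_incl) auto
  show ?thesis
  proof (cases "U = D")
    case True
    hence "generate G (insert \<one> D) = U"
      using gU[OF subgroup.one_closed[OF sU]] generate.incl[of _ "insert \<one> D" G] by blast
    thus ?thesis using that[of \<one>] by simp
  next
    case False
    then obtain u where u: "u \<in> U" "u \<notin> D" using DU by blast
    have uc: "u \<in> carrier G" using u sU subgroup.mem_carrier[OF sU] by simp
    have "D \<subset> generate G (insert u D)"
      using u generate.incl[of _ "insert u D" G] by blast
    hence "\<not> generate G (insert u D) \<subset> U"
      using chain_above_D[OF subgroup_generate_D[OF uc] _ sU] ne by blast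
    hence "U = generate G (insert u D)" using gU[OF u(1)] by blast
    thus ?thesis using that uc by blast
  qed
qed

text \<open>
  The subgroup $T = \langle [x,y], N \rangle$ lies between $\gamma_3(G)$ and $\gamma_2(G)$, so it is
  normal. Modulo $T$ the elements of $D$ are central and $x$ commutes with $y$, so all of $G$ becomes
  abelian.
\<close>
lemma D_subset_generate:
  assumes xy: "x \<in> carrier G" "y \<in> carrier G" "generate G (insert x (insert y D)) = carrier G"
  shows "D \<subseteq> generate G (insert (commutator G x y) N)"
proof -
  let ?T = "generate G (insert (commutator G x y) N)"
  have s: "commutator G x y \<in> D" using commutator_in_D xy by blast
  have sT: "subgroup ?T G" using xy N.subset by (intro generate_is_subgroup) auto
  have inT: "insert (commutator G x y) N \<subseteq> ?T" by (blast intro: generate.incl)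
  have TD: "?T \<subseteq> D"
    using s N_subset_D by (intro generate_subgroup_incl D.subgroup_axioms) auto
  have nT: "?T \<lhd> G"
    using normal_if_central_mod[OF sT] TD inT commutator_in_N by blast
  have Dg: "commutator G d g \<in> ?T" "commutator G g d \<in> ?T" if "d \<in> D" "g \<in> carrier G" for d g
  proof -
    show 1: "commutator G d g \<in> ?T" using commutator_in_N[OF that] inT by blast
    show "commutator G g d \<in> ?T"
      using commutator_mem_swap[OF sT _ _ 1] that D.subset by blast
  qed
  have xyT: "commutator G x y \<in> ?T" using inT by blast
  have yxT: "commutator G y x \<in> ?T" using commutator_mem_swap[OF sT xy(1,2) xyT] .
  have one: "commutator G g g \<in> ?T" if "g \<in> carrier G" for g
    using that generate.one by (metis commutator_eq_one_iff)
  have "commutator G g h \<in> ?T" if "g \<in> carrier G" "h \<in> carrier G" for g h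
  proof (rule commutators_of_generators[OF nT])
    show c: "insert x (insert y D) \<subseteq> carrier G" using xy D.subset by blast
    show "insert x (insert y D) \<subseteq> carrier G" by (rule c)
    show "g \<in> generate G (insert x (insert y D))" "h \<in> generate G (insert x (insert y D))"
      using that xy by simp_all
    fix a b assume ab: "a \<in> insert x (insert y D)" "b \<in> insert x (insert y D)"
    note ac = subsetD[OF c ab(1)] and bc = subsetD[OF c ab(2)]
    show "commutator G a b \<in> ?T"
      using ab ac bc Dg xyT yxT one by (elim insertE) (simp_all only:)
  qed
  thus ?thesis using derived_subset_iff[OF sT] by blast
qed

lemma pow_p_commutator_in_N:
  assumes "x \<in> carrier G" "y \<in> carrier G"
  shows "commutator G x y [^] p \<in> N"
proof (rule pow_commutator_mem[OF N.normal_axioms assms])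
  show "commutator G (commutator G x y) x \<in> N"
    by (rule commutator_in_N[OF commutator_in_D[OF assms] assms(1)])
  show "commutator G (x [^] p) y \<in> N"
    by (rule commutator_in_N[OF pow_p_mem[OF assms(1)] assms(2)])
qed

lemma card_D_le: "card D \<le> p * card N"
proof -
  obtain x y where xy: "x \<in> carrier G" "y \<in> carrier G" "generate G (insert x (insert y D)) = carrier G"
    by (rule generating_pair)
  let ?T = "generate G (insert (commutator G x y) N)"
  have "?T \<subseteq> carrier G" using xy N.subset by (intro generate_incl) auto
  hence "card D \<le> card ?T"
    using D_subset_generate[OF xy] finite_subset[OF _ finite_carrier] card_mono by blast
  also have "\<dots> \<le> p * card N"
    using xy pow_p_commutator_in_N
    by (intro card_generate_insert_le finite_carrier N.normal_axioms p_pos) auto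
  finally show ?thesis .
qed

lemma order_eq_p_power:
  obtains n where "order G = p ^ n" "coclass p G = n - nilpotency_class G"
proof -
  obtain n where n: "order G = p ^ n" using p_group by (auto simp: p_group_def)
  moreover have "Factorial_Ring.multiplicity p (p ^ n) = n"
    using p prime_gt_0_nat[OF p] by (intro multiplicity_same_power) auto
  ultimately show ?thesis using that by (simp add: coclass_def)
qed

section \<open>Class two\<close>

text \<open>
  Suppose $D$ is a proper subgroup of the centre, and choose a noncentral $x$. The centralizer of
  $x$ properly contains the centre, because it contains $x$. By \<open>chain_above_D\<close> it is all of $G$,
  which contradicts the choice of $x$.
\<close>
lemma class_2_center:
  assumes N: "N = {\<one>}" and D: "D \<noteq> {\<one>}"
  shows "group_center G = D"
proof -
  let ?Z = "group_center G"
  have Zeq: "?Z = {z \<in> carrier G. \<forall>g\<in>carrier G. commutator G z g = \<one>}"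
    unfolding group_center_def using commutator_eq_one_iff by auto
  have DZ: "D \<subseteq> ?Z" unfolding Zeq using commutator_in_N N D.subset by auto
  have Z: "subgroup ?Z G"
  proof
    have C: "subgroup {a \<in> carrier G. commutator G a g \<in> {\<one>}} G" if "g \<in> carrier G" for g
      using that by (intro subgroup_centralizer_mod one_is_normal)
    show "?Z \<subseteq> carrier G" "\<one> \<in> ?Z" by (auto simp: group_center_def)
    show "a \<otimes> b \<in> ?Z" if "a \<in> ?Z" "b \<in> ?Z" for a b
      using that subgroup.m_closed[OF C, of _ a b] by (simp add: Zeq)
    show "inv a \<in> ?Z" if "a \<in> ?Z" for a
      using that subgroup.m_inv_closed[OF C, of _ a] by (simp add: Zeq)
  qed
  have "?Z \<noteq> carrier G"
  proof
    assume "?Z = carrier G"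
    hence "D \<subseteq> {\<one>}" using derived_subset_iff[OF triv_subgroup] Zeq by auto
    thus False using D D.one_closed by blast
  qed
  then obtain x where x: "x \<in> carrier G" "x \<notin> ?Z" using subgroup.subset[OF Z] by blast
  let ?C = "{a \<in> carrier G. commutator G a x \<in> {\<one>}}"
  have C: "subgroup ?C G" using x by (intro subgroup_centralizer_mod one_is_normal)
  have ZC: "?Z \<subset> ?C"
  proof -
    have "?Z \<subseteq> ?C" using x Zeq by auto
    moreover have "x \<in> ?C" using x commutator_eq_one_iff by auto
    ultimately show ?thesis using x by blast
  qed
  have "\<not> D \<subset> ?Z"
  proof
    assume "D \<subset> ?Z"
    hence "?C = carrier G" using chain_above_D[OF Z _ C ZC] by blast
    hence "x \<otimes> g = g \<otimes> x" if "g \<in> carrier G" for g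
      using that x commutator_eq_one_iff[OF that x(1)] by auto
    thus False using x by (auto simp: group_center_def)
  qed
  thus ?thesis using DZ by blast
qed

text \<open>The subgroup is $\langle u, D \rangle$ for some $u$, and $D$ is central.\<close>
lemma class_2_derived_maximal:
  assumes N: "N = {\<one>}" and M: "M \<in> maximal_subgroups G"
  shows "derived G M \<subseteq> {\<one>}"
proof -
  obtain u where u: "u \<in> carrier G" "M = generate G (insert u D)"
    using M by (rule maximal_subgroup_generate)
  have "commutator G g h \<in> {\<one>}" if "g \<in> M" "h \<in> M" for g h
  proof (rule commutators_of_generators[OF one_is_normal _ _ _ that[unfolded u(2)]])
    show c: "insert u D \<subseteq> carrier G" using u D.subset by blast
    show "insert u D \<subseteq> carrier G" by (rule c)
    fix a b assume ab: "a \<in> insert u D" "b \<in> insert u D"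
    note ac = subsetD[OF c ab(1)] and bc = subsetD[OF c ab(2)]
    have D1: "commutator G d g = \<one>" if "d \<in> D" "g \<in> carrier G" for d g
      using commutator_in_N[OF that] N by blast
    show "commutator G a b \<in> {\<one>}"
    proof (cases "a \<in> D")
      case True
      thus ?thesis using D1 bc by simp
    next
      case False
      hence a: "a = u" using ab by blast
      show ?thesis
      proof (cases "b \<in> D")
        case True
        thus ?thesis using commutator_mem_swap[OF triv_subgroup bc ac] D1 ac by simp
      next
        case False
        thus ?thesis using a ab ac commutator_eq_one_iff[OF ac ac] by simp
      qed
    qed
  qed
  thus ?thesis using derived_subset_iff[OF triv_subgroup] by blast
qed

lemma class_2_extra_special:
  assumes N: "N = {\<one>}" and D: "D \<noteq> {\<one>}" and o: "order G = p ^ 3"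
  shows "extra_special p G" "group_exponent G = p \<or> group_exponent G = p ^ 2"
proof -
  note Z = class_2_center[OF N D]
  have "p ^ 2 * card D = p ^ 2 * p" using o order_eq by (simp add: power3_eq_cube power2_eq_square)
  hence cD: "card D = p" using p_pos by simp
  have "order (G Mod D) * p = p ^ 2 * p"
    using lagrange[OF D.subgroup_axioms] cD o
    by (simp add: order_def FactGroup_def power3_eq_cube power2_eq_square)
  hence "order (G Mod D) = p ^ 2" using p_pos by simp
  hence o2: "order (G Mod D) \<noteq> 1" using prime_gt_1_nat[OF p] by (simp add: power2_eq_square)
  have "Y [^]\<^bsub>G Mod D\<^esub> p = \<one>\<^bsub>G Mod D\<^esub>" if Y: "Y \<in> carrier (G Mod D)" for Y
  proof -
    obtain x where x: "x \<in> carrier G" "Y = D #> x" using Y by (auto simp: carrier_FactGroup)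
    show ?thesis
      using D.FactGroup_pow[OF x(1), of p] coset_join2[OF _ D.subgroup_axioms pow_p_mem[OF x(1)]] x
      by simp
  qed
  thus "extra_special p G"
    unfolding extra_special_def elementary_abelian_def Z
    using p_group cD o2 derived_quot_is_comm_group by blast
  have Dp: "d [^] p = \<one>" if d: "d \<in> D" for d
  proof -
    interpret H: group "G\<lparr>carrier := D\<rparr>" by (rule subgroup_imp_group[OF D.subgroup_axioms])
    show ?thesis using H.pow_order_eq_1[of d] d cD by (simp add: order_def flip: nat_pow_consistent)
  qed
  have "x [^] (p ^ 2) = \<one>" if "x \<in> carrier G" for x
    using Dp[OF pow_p_mem[OF that]] that by (simp add: nat_pow_pow power2_eq_square)
  moreover have "carrier G \<noteq> {\<one>}" using D D.subset D.one_closed by blast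
  ultimately show "group_exponent G = p \<or> group_exponent G = p ^ 2"
    by (intro group_exponent_cases p)
qed

end

section \<open>Class three\<close>

text \<open>Here $N$ is central and $D$ is abelian.\<close>
locale class_3_type_pp = abelianization_type_pp +
  assumes lower_central_4: "lower_central G 4 = {\<one>}"
    and metabelian: "metabelian G"
begin

lemma commutator_N:
  assumes "z \<in> N" "g \<in> carrier G"
  shows "commutator G z g = \<one>" "commutator G g z = \<one>"
proof -
  show 1: "commutator G z g = \<one>"
    using lower_central_commutator[of 3 z g] assms lower_central_4 by simp
  have "commutator G g z = inv (commutator G z g)" using assms by (simp add: inv_commutator)
  thus "commutator G g z = \<one>" using 1 by simp
qed

lemma commutator_D:
  assumes "d \<in> D" "e \<in> D"
  shows "commutator G d e = \<one>"
proof -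
  have "derived G D \<subseteq> {\<one>}" using metabelian by (simp add: metabelian_def)
  thus ?thesis using derived_subset_iff[OF triv_subgroup] assms by blast
qed

lemma subgroup_of_N_normal:
  assumes "subgroup T G" "T \<subseteq> N"
  shows "T \<lhd> G"
proof (rule normal_if_central_mod[OF assms(1)])
  fix t g assume "t \<in> T" "g \<in> carrier G"
  thus "commutator G t g \<in> T"
    using commutator_N(1)[of t g] assms(2) subgroup.one_closed[OF assms(1)] by auto
qed

lemma generate_in_N_normal:
  assumes "A \<subseteq> N"
  shows "generate G A \<lhd> G"
proof (rule subgroup_of_N_normal)
  show "subgroup (generate G A) G" using assms N.subset by (intro generate_is_subgroup) blast
  show "generate G A \<subseteq> N" using assms N.subgroup_axioms by (rule generate_subgroup_incl)
qed

lemma pow_p_commutator_D: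
  assumes "d \<in> D" "d [^] p \<in> N" "g \<in> carrier G"
  shows "commutator G d g [^] p = \<one>"
proof -
  have "commutator G d g [^] p \<in> {\<one>}"
    using assms commutator_N commutator_in_N[OF assms(1,3)] 
    by (intro pow_commutator_mem one_is_normal) auto
  thus ?thesis by simp
qed

lemma card_generate_commutator_le:
  assumes "d \<in> D" "d [^] p \<in> N" "g \<in> carrier G"
  shows "card (generate G {commutator G d g}) \<le> p"
proof -
  have "card (generate G (insert (commutator G d g) {\<one>})) \<le> p * card {\<one>}"
    using assms pow_p_commutator_D
    by (intro card_generate_insert_le finite_carrier one_is_normal p_pos) auto
  moreover have "generate G {commutator G d g} \<subseteq> generate G (insert (commutator G d g) {\<one>})"
    by (rule mono_generate) blast
  moreover have "finite (generate G (insert (commutator G d g) {\<one>}))"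
    using assms by (intro finite_subset[OF generate_incl finite_carrier]) auto
  ultimately have "card (generate G {commutator G d g}) \<le> p * card {\<one>}"
    using card_mono le_trans by blast
  thus ?thesis by simp
qed

context
  fixes x y
  assumes xy: "x \<in> carrier G" "y \<in> carrier G" "generate G (insert x (insert y D)) = carrier G"
begin

abbreviation "s \<equiv> commutator G x y"

lemma s_mem_D: "s \<in> D" using commutator_in_D xy by blast
lemma s_pow_p_mem_N: "s [^] p \<in> N" using pow_p_commutator_in_N xy by blast

text \<open>
  $N = [D,G]$ with $D = \langle s, N \rangle$ and $G = \langle x, y, D \rangle$; among the commutators
  of these generators only $[s,x]$ and $[s,y]$ can be nontrivial.
\<close>
lemma N_subset_if_commutators:
  assumes T: "T \<lhd> G" and sx: "commutator G s x \<in> T" and sy: "commutator G s y \<in> T"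
  shows "N \<subseteq> T"
  unfolding N_subset_iff[OF normal_imp_subgroup[OF T]]
proof (intro ballI)
  fix d g assume dg: "d \<in> D" "g \<in> carrier G"
  show "commutator G d g \<in> T"
  proof (rule commutators_of_generators[OF T])
    show "insert s N \<subseteq> carrier G" using s_mem_D D.subset N.subset by blast
    show "insert x (insert y D) \<subseteq> carrier G" using xy D.subset by blast
    show "d \<in> generate G (insert s N)" using D_subset_generate[OF xy] dg by blast
    show "g \<in> generate G (insert x (insert y D))" using dg xy by simp
    have one: "\<one> \<in> T" using subgroup.one_closed[OF normal_imp_subgroup[OF T]] .
    fix a b assume a: "a \<in> insert s N" and b: "b \<in> insert x (insert y D)"
    have bc: "b \<in> carrier G" using b xy D.subset by blast
    show "commutator G a b \<in> T"
    proof (cases "a \<in> N")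
      case True
      thus ?thesis using commutator_N(1)[OF _ bc] one by simp
    next
      case False
      hence "a = s" using a by blast
      thus ?thesis using b sx sy commutator_D[OF s_mem_D] one by (elim insertE) simp_all
    qed
  qed
qed

text \<open>The subgroup $\langle [s,x], [s,y] \rangle$ is built in two steps, each of which multiplies the
  size by at most $p$.\<close>
lemma card_N_le: "card N \<le> p ^ 2"
proof -
  let ?a = "commutator G s x" and ?b = "commutator G s y"
  let ?B = "generate G {?b}" and ?T = "generate G (insert ?a (generate G {?b}))"
  have a: "?a \<in> N" and b: "?b \<in> N" using commutator_in_N s_mem_D xy by blast+
  have BN: "?B \<subseteq> N" using b by (intro generate_subgroup_incl N.subgroup_axioms) auto
  have B: "?B \<lhd> G" using b by (intro generate_in_N_normal) auto
  have T: "?T \<lhd> G" using a BN by (intro generate_in_N_normal) auto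
  have "?a \<in> ?T" "?b \<in> ?T" by (auto intro!: generate.incl)
  hence "N \<subseteq> ?T" by (rule N_subset_if_commutators[OF T])
  moreover have "finite ?T"
    using finite_subset[OF _ finite_carrier] subgroup.subset[OF normal_imp_subgroup[OF T]] by blast
  ultimately have "card N \<le> card ?T" by (intro card_mono)
  also have "\<dots> \<le> p * card ?B"
    using pow_p_commutator_D[OF s_mem_D s_pow_p_mem_N xy(1)] a generate.one[of G "{?b}"]
    by (intro card_generate_insert_le finite_carrier B p_pos) auto
  also have "\<dots> \<le> p * p"
    using card_generate_commutator_le[OF s_mem_D s_pow_p_mem_N xy(2)] by simp
  finally show ?thesis by (simp add: power2_eq_square)
qed

text \<open>
  The index of $N$ in $D$ is at most $2$, so $x^2 \in D \setminus N$ means $x^2 = ns$ with $n \in N$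
  central. Thus $s = n^{-1} x^2$ commutes with $x$, and $N$ is generated by $[s,y]$ alone.
\<close>
lemma card_N_le_if_square_not_in_N:
  assumes "p = 2" "x [^] p \<notin> N"
  shows "card N \<le> p"
proof -
  have "x [^] p \<in> D" using pow_p_mem xy by blast
  hence "x [^] p \<in> (\<Union>i<p. N #> s [^] i)"
    using D_subset_generate[OF xy] generate_insert_subset[OF N.normal_axioms _ p_pos s_pow_p_mem_N] xy
    by auto
  then obtain i :: nat where i: "i < 2" "x [^] p \<in> N #> s [^] i" using assms by auto
  have "i \<noteq> 0"
  proof
    assume "i = 0"
    thus False using i assms N.subset by simp
  qed
  hence "i = 1" using i by simp
  then obtain n where n: "n \<in> N" "x [^] p = n \<otimes> s"
    using i xy by (auto simp: r_coset_def)
  let ?C = "{a \<in> carrier G. commutator G a x \<in> {\<one>}}"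
  have C: "subgroup ?C G" using xy by (intro subgroup_centralizer_mod one_is_normal)
  have "commutator G (x [^] p) x = \<one>"
    using xy by (simp add: commutator_eq_one_iff nat_pow_Suc2[symmetric])
  hence xC: "x [^] p \<in> ?C" using xy by simp
  have "n \<in> ?C" using n commutator_N xy by simp
  hence "inv n \<otimes> x [^] p \<in> ?C" using xC C by (metis subgroup.m_closed subgroup.m_inv_closed)
  moreover have "inv n \<otimes> x [^] p = s" unfolding n(2) using n(1) xy by (simp add: inv_mult_cancel)
  ultimately have sx: "commutator G s x = \<one>" by simp
  let ?T = "generate G {commutator G s y}"
  have "commutator G s y \<in> N" using commutator_in_N s_mem_D xy by blast
  hence T: "?T \<lhd> G" by (intro generate_in_N_normal) auto
  have "N \<subseteq> ?T"
    using sx by (intro N_subset_if_commutators[OF T]) (simp_all add: generate.one generate.incl)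
  moreover have "finite ?T"
    using finite_subset[OF _ finite_carrier] subgroup.subset[OF normal_imp_subgroup[OF T]] by blast
  ultimately have "card N \<le> card ?T" by (intro card_mono)
  thus ?thesis using card_generate_commutator_le[OF s_mem_D s_pow_p_mem_N xy(2)] by simp
qed

text \<open>
  Modulo $T = \langle [s,u] \rangle$, the element $u$ commutes with $D = \langle s, N \rangle$, and $D$ is
  abelian anyway; so $\langle u, D \rangle$ is abelian modulo $T$.
\<close>
lemma card_derived_generate_le:
  assumes u: "u \<in> carrier G"
  shows "card (derived G (generate G (insert u D))) \<le> p"
proof -
  let ?U = "generate G (insert u D)" and ?T = "generate G {commutator G s u}"
  have c: "commutator G s u \<in> N" using commutator_in_N s_mem_D u by blast
  hence T: "?T \<lhd> G" by (intro generate_in_N_normal) auto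
  have sT: "subgroup ?T G" using T by (rule normal_imp_subgroup)
  have Du: "commutator G d u \<in> ?T" if "d \<in> D" for d
  proof (rule commutators_of_generators[OF T])
    show "insert s N \<subseteq> carrier G" using s_mem_D D.subset N.subset by blast
    show "{u} \<subseteq> carrier G" using u by blast
    show "d \<in> generate G (insert s N)" using D_subset_generate[OF xy] that by blast
    show "u \<in> generate G {u}" by (rule generate.incl) simp
    show "commutator G a b \<in> ?T" if ab: "a \<in> insert s N" "b \<in> {u}" for a b
    proof (cases "a \<in> N")
      case True
      thus ?thesis using commutator_N(1) u ab generate.one by auto
    next
      case False
      hence "commutator G a b \<in> {commutator G s u}" using ab by blast
      thus ?thesis by (rule generate.incl)
    qed
  qed
  have "commutator G g h \<in> ?T" if "g \<in> ?U" "h \<in> ?U" for g h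
  proof (rule commutators_of_generators[OF T _ _ _ that])
    show c: "insert u D \<subseteq> carrier G" using u D.subset by blast
    show "insert u D \<subseteq> carrier G" by (rule c)
    fix a b assume ab: "a \<in> insert u D" "b \<in> insert u D"
    note ac = subsetD[OF c ab(1)] and bc = subsetD[OF c ab(2)]
    show "commutator G a b \<in> ?T"
    proof (cases "a \<in> D")
      case True
      show ?thesis
      proof (cases "b \<in> D")
        case True
        thus ?thesis using commutator_D[OF \<open>a \<in> D\<close>] generate.one by simp
      next
        case False
        thus ?thesis using Du[OF \<open>a \<in> D\<close>] ab by blast
      qed
    next
      case False
      hence [simp]: "a = u" using ab by blast
      show ?thesis
      proof (cases "b \<in> D")
        case True
        thus ?thesis using commutator_mem_swap[OF sT bc ac] Du by simp
      next
        case False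
        hence "b = u" using ab by blast
        thus ?thesis using u generate.one commutator_eq_one_iff[OF u u] by simp
      qed
    qed
  qed
  hence "derived G ?U \<subseteq> ?T" using derived_subset_iff[OF sT] by blast
  moreover have "finite ?T" using finite_subset[OF _ finite_carrier] subgroup.subset[OF sT] by blast
  ultimately have "card (derived G ?U) \<le> card ?T" by (intro card_mono)
  thus ?thesis using card_generate_commutator_le[OF s_mem_D s_pow_p_mem_N u] by simp
qed

end

lemma not_D_subset_N:
  assumes "N \<noteq> {\<one>}"
  shows "\<not> D \<subseteq> N"
proof
  assume "D \<subseteq> N"
  hence "N \<subseteq> {\<one>}" unfolding N_subset_iff[OF triv_subgroup] using commutator_N by blast
  thus False using assms N.one_closed by blast
qed

text \<open>
  If $x^2$, $y^2$ and $(xy)^2$ all lay in $N$, then so would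
  $[x,y] = (xy)^2 \cdot (y^{-1} x^{-2} y) \cdot y^{-2}$, and hence all of $D$. So one of the generating
  pairs $(x,y)$, $(y,x)$, $(xy,y)$ starts with an element whose square is outside $N$.
\<close>
lemma card_N_le_if_p_eq_2:
  assumes p2: "p = 2" and N: "N \<noteq> {\<one>}"
  shows "card N \<le> p"
proof -
  obtain x y where xy: "x \<in> carrier G" "y \<in> carrier G" "generate G (insert x (insert y D)) = carrier G"
    by (rule generating_pair)
  let ?z = "x \<otimes> y"
  have yx: "generate G (insert y (insert x D)) = carrier G"
    using xy(3) by (simp add: insert_commute)
  have zy: "generate G (insert ?z (insert y D)) = carrier G"
  proof -
    let ?H = "generate G (insert ?z (insert y D))"
    have c: "insert ?z (insert y D) \<subseteq> carrier G" using xy D.subset by blast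
    have H: "subgroup ?H G" using c by (rule generate_is_subgroup)
    have inH: "insert ?z (insert y D) \<subseteq> ?H" by (blast intro: generate.incl)
    have "?z \<otimes> inv y \<in> ?H"
      using inH by (intro subgroup.m_closed[OF H, of ?z] subgroup.m_inv_closed[OF H]) auto
    hence "x \<in> ?H" using xy by (simp add: m_assoc)
    hence "generate G (insert x (insert y D)) \<subseteq> ?H"
      using inH H by (intro generate_subgroup_incl) auto
    thus ?thesis using xy(3) subgroup.subset[OF H] by blast
  qed
  have "\<not> (x [^] p \<in> N \<and> y [^] p \<in> N \<and> ?z [^] p \<in> N)"
  proof
    assume sq: "x [^] p \<in> N \<and> y [^] p \<in> N \<and> ?z [^] p \<in> N"
    have "inv y \<otimes> inv (x [^] p) \<otimes> y \<in> N"
      using sq xy by (intro N.inv_op_closed1) auto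
    hence "?z [^] p \<otimes> ((inv y \<otimes> inv (x [^] p) \<otimes> y) \<otimes> inv (y [^] p)) \<in> N" using sq by simp
    moreover have "?z [^] p \<otimes> ((inv y \<otimes> inv (x [^] p) \<otimes> y) \<otimes> inv (y [^] p)) = commutator G x y"
      using xy p2 by (simp add: numeral_2_eq_2 commutator_def group_word_simps)
    ultimately have "insert (commutator G x y) N \<subseteq> N" by simp
    hence "generate G (insert (commutator G x y) N) \<subseteq> N"
      by (rule generate_subgroup_incl[OF _ N.subgroup_axioms])
    thus False using D_subset_generate[OF xy] not_D_subset_N[OF N] by blast
  qed
  moreover have "?z \<in> carrier G" using xy by simp
  ultimately show ?thesis
    using card_N_le_if_square_not_in_N[OF xy p2] card_N_le_if_square_not_in_N[OF xy(2,1) yx p2]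
      card_N_le_if_square_not_in_N[OF _ xy(2) zy p2] by blast
qed

text \<open>
  The bounds $|G| = p^2|D|$, $|D| \le p\,|N|$ and $|N| \le p^2$ leave no slack when $|G| \ge p^5$; the
  resulting $|N| > p$ excludes $p = 2$ and is too large for the derived subgroup of a maximal
  subgroup.
\<close>
lemma class_3_order_parity_polarization:
  assumes N: "N \<noteq> {\<one>}" and o: "order G = p ^ n" and n: "n \<ge> 5"
  shows "n = 5" "p \<ge> 3" "odd p" "M \<in> maximal_subgroups G \<Longrightarrow> \<not> N \<subseteq> derived G M"
proof -
  obtain x y where xy: "x \<in> carrier G" "y \<in> carrier G" "generate G (insert x (insert y D)) = carrier G"
    by (rule generating_pair)
  have p1: "p > 1" using prime_gt_1_nat[OF p] .
  have "p ^ n = p ^ 2 * card D" using o order_eq by simp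
  also have "\<dots> \<le> p ^ 2 * (p * card N)" using card_D_le by simp
  finally have le: "p ^ n \<le> p ^ 3 * card N" by (simp add: power3_eq_cube power2_eq_square)
  also have "\<dots> \<le> p ^ 3 * p ^ 2" using card_N_le[OF xy] by (rule mult_le_mono2)
  also have "\<dots> = p ^ 5" by (simp flip: power_add)
  finally have "n \<le> 5" using p1 power_le_imp_le_exp by blast
  thus n5: "n = 5" using n by simp
  have "p ^ 3 * p ^ 2 \<le> p ^ 3 * card N" using le n5 by (simp flip: power_add)
  hence "p ^ 2 \<le> card N" unfolding mult_le_cancel1 using p_pos by simp
  moreover have "p < p ^ 2" using p1 by (simp add: power2_eq_square)
  ultimately have N_gt: "p < card N" by simp
  hence "p \<noteq> 2" using card_N_le_if_p_eq_2[OF _ N] by auto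
  thus "p \<ge> 3" using p1 by simp
  thus "odd p" using prime_odd_nat[OF p] by simp
  show "\<not> N \<subseteq> derived G M" if M: "M \<in> maximal_subgroups G"
  proof
    assume NM: "N \<subseteq> derived G M"
    obtain u where u: "u \<in> carrier G" "M = generate G (insert u D)"
      using M by (rule maximal_subgroup_generate)
    have "M \<subseteq> carrier G" using M subgroup.subset by (auto simp: maximal_subgroups_def)
    hence "finite (derived G M)" using derived_in_carrier finite_subset[OF _ finite_carrier] by blast
    hence "card N \<le> card (derived G M)" using NM card_mono by blast
    thus False using card_derived_generate_le[OF xy u(1)] u(2) N_gt by simp
  qed
qed

end

theorem theorem6p3:
  fixes p :: nat and G :: "('a, 'b) monoid_scheme" and U :: "nat \<Rightarrow> 'a set"
  assumes "Factorial_Ring.prime p"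
    and "p_group p G"
    and "metabelian G"
    and "abelianization G \<cong> integer_mod_group p \<times>\<times> integer_mod_group p"
    and "bij_betw U {1..p + 1} (maximal_subgroups G)"
  shows "(coclass p G \<ge> 2 \<and> nilpotency_class G = 3 \<longrightarrow>
            p \<ge> 3 \<and> odd p \<and> coclass p G = 2 \<and>
            Pol p G U = {1..p + 1} \<and> Stb p G U = {}) \<and>
         (coclass p G = 1 \<and> nilpotency_class G = 2 \<longrightarrow>
            extra_special p G \<and> order G = p ^ 3 \<and>
            (group_exponent G = p \<or> group_exponent G = p ^ 2) \<and>
            Pol p G U = {1..p + 1} \<and> Stb p G U = {})"
proof -
  interpret abelianization_type_pp G p
    using assms(1,2,4) by (rule abelianization_type_ppI)
  obtain n where n: "order G = p ^ n" and cc: "coclass p G = n - nilpotency_class G"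
    by (rule order_eq_p_power)
  note cl = p_group_nilpotency_class[OF assms(1,2)]
  note pol = total_polarization[OF assms(5)]
  show ?thesis
  proof (intro conjI[of "_ \<longrightarrow> _"] impI)
    assume A: "coclass p G \<ge> 2 \<and> nilpotency_class G = 3"
    interpret class_3_type_pp G p
      using cl(1) A assms(3) by unfold_locales simp_all
    have N: "N \<noteq> {\<one>\<^bsub>G\<^esub>}" using cl(2)[of 2] A by simp
    have n5: "n \<ge> 5" using A cc by (elim conjE) simp
    note c3 = class_3_order_parity_polarization[OF N n n5]
    have "\<not> lower_central G (nilpotency_class G) \<subseteq> derived G M" if "M \<in> maximal_subgroups G" for M
      using c3(4)[OF that] A by simp
    thus "p \<ge> 3 \<and> odd p \<and> coclass p G = 2 \<and> Pol p G U = {1..p + 1} \<and> Stb p G U = {}"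
      using c3(1-3) cc A pol by simp
  next
    assume A: "coclass p G = 1 \<and> nilpotency_class G = 2"
    have N: "N = {\<one>\<^bsub>G\<^esub>}" using cl(1) A by simp
    have D: "D \<noteq> {\<one>\<^bsub>G\<^esub>}" using cl(2)[of 1] A lower_central_2 by (simp add: numeral_2_eq_2)
    have o: "order G = p ^ 3" using n cc A by (cases "n = 3") auto
    have "\<not> lower_central G (nilpotency_class G) \<subseteq> derived G M" if "M \<in> maximal_subgroups G" for M
      using class_2_derived_maximal[OF N that] D D.one_closed A lower_central_2 by auto
    thus "extra_special p G \<and> order G = p ^ 3 \<and> (group_exponent G = p \<or> group_exponent G = p ^ 2) \<and>
        Pol p G U = {1..p + 1} \<and> Stb p G U = {}"
      using class_2_extra_special[OF N D o] o pol by simp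
  qed
qed

end
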